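(* Let $f\in\mathrm{Hol}(\mathbb{D},\mathbb{D})$ and let $w\in\mathbb{D}$. Then there exists $\gamma\in\mathrm{Aut}(\mathbb{D})$ such that \[ \omega\bigl(f(z),\gamma(z)\bigr)\le 2e^{4\omega(z,w)}\bigl(1-f^\#(w)\bigr) \] for all $z\in\mathbb{D}$.
   Context: $\mathbb{D}$ is the open unit disc; $\mathrm{Hol}(\mathbb{D},\mathbb{D})$ is the set of holomorphic self-maps of $\mathbb{D}$ and $\mathrm{Aut}(\mathbb{D})$ the group of conformal automorphisms of $\mathbb{D}$. The hyperbolic distance $\omega$ on $\mathbb{D}$ is normalized by $\sinh\omega(z,w)=\frac{|z-w|}{\sqrt{(1-|z|^2)(1-|w|^2)}}$ (so $\omega(0,z)=\frac12\log\frac{1+|z|}{1-|z|}$). The hyperbolic distortion of $f$ is $f^\#(z)=\lim_{w\to z}\omega(f(z),f(w))/\omega(z,w)=|f'(z)|\frac{1-|z|^2}{1-|f(z)|^2}$. *)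

theory Defs
  imports "HOL-Complex_Analysis.Complex_Analysis"
begin

abbreviation unit_disc :: "complex set" (\<open>\<D>\<close>)
  where "\<D> \<equiv> ball 0 1"

definition Hol_disc :: "(complex \<Rightarrow> complex) set"
  where "Hol_disc = {f. f holomorphic_on \<D> \<and> f ` \<D> \<subseteq> \<D>}"

text \<open>Functions are total, so members are only determined on \<open>\<D>\<close>; bijectivity is that of the
  restriction to \<open>\<D>\<close>, whose inverse is required to be holomorphic as well.\<close>

definition Aut_disc :: "(complex \<Rightarrow> complex) set"
  where "Aut_disc = {g. bij_betw g \<D> \<D> \<and> g holomorphic_on \<D> \<and> inv_into \<D> g holomorphic_on \<D>}"

definition hyp_dist :: "complex \<Rightarrow> complex \<Rightarrow> real"
  where "hyp_dist z w = arsinh (norm (z - w) / sqrt ((1 - (norm z)\<^sup>2) * (1 - (norm w)\<^sup>2)))"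

definition hyp_distortion :: "(complex \<Rightarrow> complex) \<Rightarrow> complex \<Rightarrow> real"
  where "hyp_distortion f z = Lim (at z) (\<lambda>w. hyp_dist (f z) (f w) / hyp_dist z w)"

text \<open>The normalisation: curvature \<open>-4\<close>.\<close>

lemma hyp_dist_0:
  assumes "z \<in> \<D>"
  shows "hyp_dist 0 z = ln ((1 + norm z) / (1 - norm z)) / 2"
proof -
  define r where "r = norm z"
  have r: "0 \<le> r" "r < 1" using assms by (auto simp: r_def)
  define s where "s = sqrt (1 - r\<^sup>2)"
  have s2: "s\<^sup>2 = 1 - r\<^sup>2" "s > 0"
    using r by (auto simp: s_def abs_square_less_1 power_le_one)
  have q: "sqrt ((r / s)\<^sup>2 + 1) = 1 / s"
  proof (rule real_sqrt_unique)
    show "(1 / s)\<^sup>2 = (r / s)\<^sup>2 + 1" using s2 by (simp add: field_simps)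
  qed (use s2 in auto)
  have "hyp_dist 0 z = arsinh (r / s)" by (simp add: hyp_dist_def r_def s_def)
  also have "\<dots> = ln (r / s + 1 / s)" by (simp add: arsinh_real_def q)
  also have "\<dots> = ln (((1 + r) / s)\<^sup>2) / 2"
    using r s2 by (simp add: ln_realpow add_divide_distrib add.commute add_pos_nonneg)
  also have "((1 + r) / s)\<^sup>2 = (1 + r) / (1 - r)"
  proof -
    have "s\<^sup>2 = (1 + r) * (1 - r)" using s2 by (simp add: power2_eq_square algebra_simps)
    thus ?thesis using r by (simp add: power_divide power2_eq_square)
  qed
  finally show ?thesis by (simp add: r_def)
qed

text \<open>The limit exists, so \<open>hyp_distortion\<close> is never the junk value of \<open>Lim\<close> on \<open>\<D>\<close>.\<close>

lemma hyp_distortion_tendsto: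
  assumes f: "f \<in> Hol_disc" and z: "z \<in> \<D>"
  shows "((\<lambda>w. hyp_dist (f z) (f w) / hyp_dist z w) \<longlongrightarrow>
           norm (deriv f z) * (1 - (norm z)\<^sup>2) / (1 - (norm (f z))\<^sup>2)) (at z)"
proof -
  have fz: "f z \<in> \<D>" and hol: "f holomorphic_on \<D>" using f z unfolding Hol_disc_def by blast+
  have d: "(f has_field_derivative deriv f z) (at z)"
    using hol z by (simp add: holomorphic_derivI)
  have cont: "isCont f z" using d by (rule DERIV_isCont)
  define q where "q x = (if x = 0 then 1 else arsinh x / x)" for x :: real
  have "((\<lambda>x::real. arsinh x) has_field_derivative 1) (at 0)"
    by (auto intro!: derivative_eq_intros)
  hence "(\<lambda>x::real. arsinh x / x) \<midarrow>0\<rightarrow> 1" by (simp add: has_field_derivative_iff)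
  hence "q \<midarrow>0\<rightarrow> 1"
    by (rule Lim_transform_eventually) (auto simp: q_def eventually_at_filter)
  hence cq: "isCont q 0" by (simp add: isCont_def q_def)
  have qmul: "arsinh x = q x * x" for x by (simp add: q_def)
  have pos: "1 - (norm z)\<^sup>2 > 0" "1 - (norm (f z))\<^sup>2 > 0"
    using z fz by (auto simp: abs_square_less_1)
  define A where "A w = norm (z - w) / sqrt ((1 - (norm z)\<^sup>2) * (1 - (norm w)\<^sup>2))" for w
  define B where "B w = norm (f z - f w) / sqrt ((1 - (norm (f z))\<^sup>2) * (1 - (norm (f w))\<^sup>2))" for w
  define C where "C w = sqrt ((1 - (norm z)\<^sup>2) * (1 - (norm w)\<^sup>2)) /
      sqrt ((1 - (norm (f z))\<^sup>2) * (1 - (norm (f w))\<^sup>2))" for w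
  have tf: "(f \<longlongrightarrow> f z) (at z)" using cont by (simp add: isCont_def)
  have "(A \<longlongrightarrow> norm (z - z) / sqrt ((1 - (norm z)\<^sup>2) * (1 - (norm z)\<^sup>2))) (at z)"
    unfolding A_def by (intro tendsto_intros) (use pos in auto)
  hence A0: "(A \<longlongrightarrow> 0) (at z)" by simp
  have "(B \<longlongrightarrow> norm (f z - f z) / sqrt ((1 - (norm (f z))\<^sup>2) * (1 - (norm (f z))\<^sup>2))) (at z)"
    unfolding B_def by (intro tendsto_intros tf) (use pos in auto)
  hence B0: "(B \<longlongrightarrow> 0) (at z)" by simp
  have "(C \<longlongrightarrow> sqrt ((1 - (norm z)\<^sup>2) * (1 - (norm z)\<^sup>2)) /
      sqrt ((1 - (norm (f z))\<^sup>2) * (1 - (norm (f z))\<^sup>2))) (at z)"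
    unfolding C_def by (intro tendsto_intros tf) (use pos in auto)
  hence C0: "(C \<longlongrightarrow> (1 - (norm z)\<^sup>2) / (1 - (norm (f z))\<^sup>2)) (at z)"
    using pos by simp
  have D0: "((\<lambda>w. norm ((f w - f z) / (w - z))) \<longlongrightarrow> norm (deriv f z)) (at z)"
    by (intro tendsto_norm) (use d in \<open>simp add: has_field_derivative_iff\<close>)
  have qA: "((\<lambda>w. q (A w)) \<longlongrightarrow> 1) (at z)" and qB: "((\<lambda>w. q (B w)) \<longlongrightarrow> 1) (at z)"
    using isCont_tendsto_compose[OF cq A0] isCont_tendsto_compose[OF cq B0] by (auto simp: q_def)
  have "((\<lambda>w. q (B w) / q (A w) * (norm ((f w - f z) / (w - z)) * C w)) \<longlongrightarrow>
      1 / 1 * (norm (deriv f z) * ((1 - (norm z)\<^sup>2) / (1 - (norm (f z))\<^sup>2)))) (at z)"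
    by (intro tendsto_mult tendsto_divide qA qB D0 C0) auto
  hence lim: "((\<lambda>w. q (B w) / q (A w) * (norm ((f w - f z) / (w - z)) * C w)) \<longlongrightarrow>
      norm (deriv f z) * (1 - (norm z)\<^sup>2) / (1 - (norm (f z))\<^sup>2)) (at z)" by simp
  have "q (B w) / q (A w) * (norm ((f w - f z) / (w - z)) * C w) =
      hyp_dist (f z) (f w) / hyp_dist z w" for w
  proof -
    have "hyp_dist (f z) (f w) / hyp_dist z w = q (B w) / q (A w) * (B w / A w)"
      by (simp add: hyp_dist_def A_def[symmetric] B_def[symmetric] qmul)
    also have "B w / A w = norm ((f w - f z) / (w - z)) * C w"
      by (simp add: A_def B_def C_def norm_divide norm_minus_commute)
    finally show ?thesis by simp
  qed
  with lim show ?thesis by simp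
qed

lemma hyp_distortion_eq:
  assumes "f \<in> Hol_disc" and "z \<in> \<D>"
  shows "hyp_distortion f z = norm (deriv f z) * (1 - (norm z)\<^sup>2) / (1 - (norm (f z))\<^sup>2)"
  unfolding hyp_distortion_def by (rule tendsto_Lim[OF _ hyp_distortion_tendsto[OF assms]]) simp

end

theory Submission
  imports Defs
begin

text \<open>
  Moebius maps are isometries of the hyperbolic distance.  Composing \<open>f\<close> with such maps on both
  sides moves \<open>w\<close> and \<open>f w\<close> to the origin without changing either side of the inequality, the
  distortion turning into the modulus \<open>a\<close> of the derivative at \<open>0\<close>
  (\<open>hyp_distortion_Moebius_conjugate\<close>).

  A self-map \<open>F\<close> fixing the origin is compared with the rotation \<open>z \<mapsto> \<alpha> z\<close>, where
  \<open>deriv F 0 = \<alpha> a\<close> (\<open>close_to_rotation\<close>).  Write \<open>F z = \<alpha> z k z\<close>.  Unless \<open>F\<close> is itself a rotation,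
  the Schwarz lemma makes \<open>k\<close> a self-map of the disc, and \<open>k 0 = a\<close>.  When \<open>a\<close> is close to \<open>1\<close>, so
  is \<open>k\<close> on every smaller disc: the Schwarz--Pick inequality gives, with \<open>r = norm z\<close>,
  \<open>norm (1 - k z) \<le> (1 - a) (1 + r) / (1 - r)\<close> (\<open>norm_one_minus_le_of_Hol_disc\<close>).  As \<open>F z\<close> and
  \<open>\<alpha> z\<close> both have modulus at most \<open>r\<close>, their hyperbolic distance is at most
  \<open>norm (F z - \<alpha> z) / (1 - r\<^sup>2) \<le> r (1 - a) / (1 - r)\<^sup>2\<close>.  On the other side,
  \<open>exp (4 * hyp_dist z 0) = ((1 + r) / (1 - r))\<^sup>2\<close>, and \<open>r \<le> 2 (1 + r)\<^sup>2\<close> leaves ample room.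
  Undoing the composition turns the rotation into the automorphism \<open>\<gamma>\<close>.
\<close>

section \<open>Hyperbolic isometries\<close>

lemma one_minus_cnj_mult_ne_0:
  fixes a z :: complex
  assumes "norm a < 1" "norm z < 1"
  shows "1 - cnj a * z \<noteq> 0"
proof
  assume "1 - cnj a * z = 0"
  hence "norm a * norm z = 1" by (metis complex_mod_cnj eq_iff_diff_eq_0 norm_mult norm_one)
  moreover have "norm a * norm z < 1" using assms by (metis norm_mult norm_mult_less mult_1)
  ultimately show False by simp
qed

lemma Moebius_function_one_minus_norm_sq:
  assumes "norm a < 1" "norm z < 1"
  shows "1 - (norm (Moebius_function 0 a z))\<^sup>2
    = (1 - (norm a)\<^sup>2) * (1 - (norm z)\<^sup>2) / (norm (1 - cnj a * z))\<^sup>2"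
proof -
  have "(norm (1 - cnj a * z))\<^sup>2 - (norm (z - a))\<^sup>2 = (1 - (norm a)\<^sup>2) * (1 - (norm z)\<^sup>2)"
    unfolding cmod_power2 by (simp add: power2_eq_square) (simp add: algebra_simps)
  thus ?thesis using one_minus_cnj_mult_ne_0[OF assms]
    by (simp add: Moebius_function_simple norm_divide power_divide field_simps)
qed

lemma Moebius_function_diff:
  assumes "norm a < 1" "norm z < 1" "norm w < 1"
  shows "Moebius_function 0 a z - Moebius_function 0 a w
    = (z - w) * of_real (1 - (norm a)\<^sup>2) / ((1 - cnj a * z) * (1 - cnj a * w))"
proof -
  have "of_real (1 - (norm a)\<^sup>2) = 1 - a * cnj a" by (simp flip: complex_norm_square of_real_power)
  thus ?thesis using one_minus_cnj_mult_ne_0[OF assms(1)] assms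
    by (simp only: Moebius_function_simple) (simp add: field_simps)
qed

text \<open>A Moebius map with parameter \<open>a\<close> multiplies \<open>norm (z - w)\<close> and
  \<open>sqrt ((1 - (norm z)\<^sup>2) * (1 - (norm w)\<^sup>2))\<close> by the same factor
  \<open>(1 - (norm a)\<^sup>2) / (norm (1 - cnj a * z) * norm (1 - cnj a * w))\<close>.\<close>

lemma hyp_dist_Moebius_function:
  assumes "norm a < 1" "norm z < 1" "norm w < 1"
  shows "hyp_dist (Moebius_function 0 a z) (Moebius_function 0 a w) = hyp_dist z w"
proof -
  define A where "A = 1 - (norm a)\<^sup>2"
  define P where "P = norm (1 - cnj a * z) * norm (1 - cnj a * w)"
  define Q where "Q = (1 - (norm z)\<^sup>2) * (1 - (norm w)\<^sup>2)"
  have A: "A > 0" using assms by (simp add: A_def abs_square_less_1)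
  have P: "P > 0" using one_minus_cnj_mult_ne_0[OF assms(1)] assms by (simp add: P_def)
  have num: "norm (Moebius_function 0 a z - Moebius_function 0 a w) = norm (z - w) * A / P"
    unfolding Moebius_function_diff[OF assms] norm_divide norm_mult P_def norm_of_real
    using A by (simp add: A_def)
  have den: "(1 - (norm (Moebius_function 0 a z))\<^sup>2) * (1 - (norm (Moebius_function 0 a w))\<^sup>2)
      = (A / P)\<^sup>2 * Q"
    unfolding Moebius_function_one_minus_norm_sq[OF assms(1,2)]
      Moebius_function_one_minus_norm_sq[OF assms(1,3)] A_def P_def Q_def
    by (simp add: power2_eq_square mult.commute mult.left_commute)
  have "sqrt ((A / P)\<^sup>2 * Q) = A / P * sqrt Q"
    using A P by (simp add: real_sqrt_mult)
  thus ?thesis using A P by (simp add: hyp_dist_def num den flip: Q_def)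
qed

lemma hyp_dist_commute: "hyp_dist z w = hyp_dist w z"
  by (simp add: hyp_dist_def norm_minus_commute mult.commute)

lemma Moebius_function_in_Hol_disc:
  assumes "norm a < 1"
  shows "Moebius_function 0 a \<in> Hol_disc"
  using assms Moebius_function_holomorphic Moebius_function_norm_lt_1 by (auto simp: Hol_disc_def)

lemma rotation_in_Hol_disc:
  assumes "norm \<alpha> = 1"
  shows "(\<lambda>z. \<alpha> * z) \<in> Hol_disc"
  using assms by (auto simp: Hol_disc_def norm_mult intro!: holomorphic_intros)

lemma comp_in_Hol_disc:
  assumes "f \<in> Hol_disc" "g \<in> Hol_disc"
  shows "g \<circ> f \<in> Hol_disc"
  using assms by (auto simp: Hol_disc_def intro: holomorphic_on_compose_gen)

lemma Aut_discI:
  assumes g: "g \<in> Hol_disc" and h: "h \<in> Hol_disc"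
    and hg: "\<And>z. z \<in> \<D> \<Longrightarrow> h (g z) = z" and gh: "\<And>z. z \<in> \<D> \<Longrightarrow> g (h z) = z"
  shows "g \<in> Aut_disc"
proof -
  have bij: "bij_betw g \<D> \<D>"
    by (rule bij_betw_byWitness[where f' = h]) (use assms in \<open>auto simp: Hol_disc_def\<close>)
  have "inv_into \<D> g z = h z" if "z \<in> \<D>" for z
  proof (rule inv_into_f_eq)
    show "inj_on g \<D>" using bij by (rule bij_betw_imp_inj_on)
    show "h z \<in> \<D>" using h that unfolding Hol_disc_def by blast
    show "g (h z) = z" using that by (rule gh)
  qed
  hence "inv_into \<D> g holomorphic_on \<D>"
    using h holomorphic_transform[of h \<D> "inv_into \<D> g"] by (simp add: Hol_disc_def)
  thus ?thesis using bij g by (simp add: Aut_disc_def Hol_disc_def)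
qed

text \<open>The hyperbolic difference quotients of \<open>F\<close> at \<open>0\<close> are those of \<open>f\<close> at \<open>w\<close>, read through the
  isometry \<open>Moebius_function 0 (- w)\<close>, which sends \<open>0\<close> to \<open>w\<close>.  Since \<open>F\<close> fixes \<open>0\<close>, the conformal
  factors in the limit of the former are \<open>1\<close>, so that it is the modulus of the derivative.\<close>

lemma hyp_distortion_Moebius_conjugate:
  assumes f: "f \<in> Hol_disc" and w: "w \<in> \<D>"
  defines "F \<equiv> Moebius_function 0 (f w) \<circ> f \<circ> Moebius_function 0 (- w)"
  shows "norm (deriv F 0) = hyp_distortion f w"
proof -
  define T where "T = Moebius_function 0 (- w)"
  have fD: "norm (f z) < 1" if "norm z < 1" for z using f that by (force simp: Hol_disc_def)
  have w1: "norm w < 1" using w by simp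
  have T0: "T 0 = w" by (simp add: T_def Moebius_function_of_zero)
  have Tinv: "Moebius_function 0 w (T u) = u" if "norm u < 1" for u
    unfolding T_def using Moebius_function_compose[of w "-w" u] w1 that by simp
  have TD: "norm (T u) < 1" if "norm u < 1" for u
    unfolding T_def using w1 that by (intro Moebius_function_norm_lt_1) auto
  have "F \<in> Hol_disc" unfolding F_def using w1 fD[OF w1] f
    by (intro comp_in_Hol_disc Moebius_function_in_Hol_disc) auto
  moreover have "F 0 = 0" by (simp add: F_def T0[unfolded T_def] Moebius_function_eq_zero)
  ultimately have lim1:
    "((\<lambda>u. hyp_dist (F 0) (F u) / hyp_dist 0 u) \<longlongrightarrow> norm (deriv F 0)) (at 0)"
    using hyp_distortion_tendsto[of F 0] by simp
  have "isCont T 0"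
    unfolding T_def using Moebius_function_holomorphic[of "-w" 0] w1
    by (auto intro!: continuous_on_interior[OF holomorphic_on_imp_continuous_on])
  hence lT: "T \<midarrow>0\<rightarrow> w" by (simp add: isCont_def T0)
  have D: "eventually (\<lambda>u. norm u < 1) (at (0::complex))"
    unfolding eventually_at by (rule exI[of _ 1]) simp
  have ne: "eventually (\<lambda>u. T u \<noteq> w) (at 0)"
    using D eventually_neq_at_within[of 0 0 UNIV]
  proof eventually_elim
    case (elim u)
    have "u = 0" if "T u = w" using Tinv[of u] that elim by (simp add: Moebius_function_eq_zero)
    thus ?case using elim by auto
  qed
  have "filterlim T (at w) (at 0)" using lT ne by (simp add: filterlim_at)
  from filterlim_compose[OF hyp_distortion_tendsto[OF f w] this]
  have "((\<lambda>u. hyp_dist (f w) (f (T u)) / hyp_dist w (T u)) \<longlongrightarrow> hyp_distortion f w) (at 0)"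
    by (simp add: hyp_distortion_eq[OF f w])
  moreover have "eventually (\<lambda>u. hyp_dist (f w) (f (T u)) / hyp_dist w (T u)
      = hyp_dist (F 0) (F u) / hyp_dist 0 u) (at 0)"
    using D
  proof eventually_elim
    case (elim u)
    have "hyp_dist (F 0) (F u) = hyp_dist (f w) (f (T u))"
      using hyp_dist_Moebius_function[of "f w" "f w" "f (T u)"] fD TD w1 elim
      by (simp add: F_def T0 flip: T_def)
    moreover have "hyp_dist w (T u) = hyp_dist 0 u"
      using hyp_dist_Moebius_function[of "-w" 0 u] w1 elim by (simp add: T0 flip: T_def)
    ultimately show ?case by simp
  qed
  ultimately have "((\<lambda>u. hyp_dist (F 0) (F u) / hyp_dist 0 u) \<longlongrightarrow> hyp_distortion f w) (at 0)"
    by (rule Lim_transform_eventually)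
  thus ?thesis using lim1 tendsto_unique by (metis trivial_limit_at)
qed

section \<open>Quantitative rigidity at the origin\<close>

lemma arsinh_le_self:
  fixes x :: real
  assumes "0 \<le> x"
  shows "arsinh x \<le> x"
proof -
  have "0 - arsinh 0 \<le> x - arsinh x"
  proof (rule DERIV_nonneg_imp_nondecreasing[OF assms])
    fix t :: real
    show "\<exists>y. ((\<lambda>t. t - arsinh t) has_real_derivative y) (at t) \<and> 0 \<le> y"
      by (rule exI[of _ "1 - 1 / sqrt (t\<^sup>2 + 1)"])
        (auto intro!: derivative_eq_intros simp: divide_le_eq add_nonneg_pos)
  qed
  thus ?thesis by simp
qed

text \<open>The Schwarz lemma for \<open>k\<close> followed by the Moebius map that sends \<open>k 0\<close> to \<open>0\<close>.  Clearing the
  denominator keeps later estimates free of the inverse Moebius map.\<close>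

lemma Schwarz_Pick_origin:
  assumes k: "k \<in> Hol_disc" and z: "norm z < 1"
  shows "norm (k z - k 0) \<le> norm z * norm (1 - cnj (k 0) * k z)"
proof -
  have kD: "norm (k z) < 1" if "norm z < 1" for z using k that by (force simp: Hol_disc_def)
  define g where "g = Moebius_function 0 (k 0) \<circ> k"
  have g: "g \<in> Hol_disc"
    unfolding g_def using k kD by (intro comp_in_Hol_disc Moebius_function_in_Hol_disc) auto
  hence gD: "g holomorphic_on \<D>" "\<And>z. norm z < 1 \<Longrightarrow> norm (g z) < 1"
    by (force simp: Hol_disc_def)+
  have "norm (g z) \<le> norm z"
    by (rule Schwarz_Lemma(1)[OF gD(1) _ gD(2) z]) (simp_all add: g_def Moebius_function_eq_zero)
  moreover have "norm (1 - cnj (k 0) * k z) > 0"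
    using one_minus_cnj_mult_ne_0[of "k 0" "k z"] kD z by simp
  ultimately show ?thesis
    by (simp add: g_def Moebius_function_simple norm_divide divide_le_eq)
qed

text \<open>The deficit \<open>1 - a\<close> at the origin controls the deficit \<open>1 - k z\<close> everywhere.  In the
  Schwarz--Pick inequality \<open>norm (k z - a) \<le> norm z * norm (1 - a * k z)\<close>, replacing \<open>a\<close> by \<open>1\<close>
  on either side costs at most \<open>1 - a\<close> in the norm, and what remains on the right is
  \<open>norm (1 - k z)\<close> with the factor \<open>norm z < 1\<close>, which is absorbed on the left.\<close>

lemma norm_one_minus_le_of_Hol_disc:
  assumes k: "k \<in> Hol_disc" and k0: "k 0 = of_real a" "0 \<le> a" and z: "norm z < 1"
  shows "norm (1 - k z) * (1 - norm z) \<le> (1 - a) * (1 + norm z)"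
proof -
  define r where "r = norm z"
  have "norm (k 0) < 1" using k by (force simp: Hol_disc_def)
  hence a1: "a < 1" using k0 by simp
  have "1 - of_real a * k z = of_real (1 - a) + of_real a * (1 - k z)" by (simp add: algebra_simps)
  hence "norm (1 - of_real a * k z) \<le> norm (complex_of_real (1 - a)) + norm (of_real a * (1 - k z))"
    by (metis norm_triangle_ineq)
  hence 1: "norm (1 - of_real a * k z) \<le> (1 - a) + a * norm (1 - k z)"
    using a1 k0 by (simp add: norm_mult del: of_real_diff)
  have "1 - k z = of_real (1 - a) - (k z - of_real a)" by simp
  hence "norm (1 - k z) \<le> norm (complex_of_real (1 - a)) + norm (k z - of_real a)"
    by (metis norm_triangle_ineq4)
  also have "\<dots> \<le> (1 - a) + r * norm (1 - of_real a * k z)"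
    using Schwarz_Pick_origin[OF k z] a1 k0 by (simp add: r_def del: of_real_diff)
  also have "\<dots> \<le> (1 - a) + r * ((1 - a) + a * norm (1 - k z))"
    using 1 by (intro add_left_mono mult_left_mono) (auto simp: r_def)
  also have "\<dots> \<le> (1 - a) + r * ((1 - a) + norm (1 - k z))"
    using a1 by (intro add_left_mono mult_left_mono) (auto simp: r_def mult_left_le_one_le k0)
  finally show ?thesis by (simp add: algebra_simps r_def)
qed

lemma hyp_dist_le_of_norm_le:
  assumes "norm z \<le> r" "norm w \<le> r" "r < 1"
  shows "hyp_dist z w \<le> norm (z - w) / (1 - r\<^sup>2)"
proof -
  have r0: "0 \<le> r" using assms norm_ge_zero order_trans by blast
  have r1: "1 - r\<^sup>2 > 0" using assms r0 by (simp add: abs_square_less_1)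
  have le: "1 - r\<^sup>2 \<le> 1 - (norm z)\<^sup>2" "1 - r\<^sup>2 \<le> 1 - (norm w)\<^sup>2"
    using assms by (auto intro: power_mono)
  have "(1 - r\<^sup>2)\<^sup>2 \<le> (1 - (norm z)\<^sup>2) * (1 - (norm w)\<^sup>2)"
    unfolding power2_eq_square[of "1 - r\<^sup>2"] using le r1 by (intro mult_mono) auto
  hence "1 - r\<^sup>2 \<le> sqrt ((1 - (norm z)\<^sup>2) * (1 - (norm w)\<^sup>2))"
    by (rule real_le_rsqrt)
  hence "norm (z - w) / sqrt ((1 - (norm z)\<^sup>2) * (1 - (norm w)\<^sup>2)) \<le> norm (z - w) / (1 - r\<^sup>2)"
    using r1 by (intro frac_le) auto
  moreover have "hyp_dist z w \<le> norm (z - w) / sqrt ((1 - (norm z)\<^sup>2) * (1 - (norm w)\<^sup>2))"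
    unfolding hyp_dist_def using le r1 by (intro arsinh_le_self) auto
  ultimately show ?thesis by linarith
qed

lemma exp_hyp_dist_0:
  assumes "norm z < 1"
  shows "exp (4 * hyp_dist z 0) = ((1 + norm z) / (1 - norm z))\<^sup>2"
proof -
  have pos: "(1 + norm z) / (1 - norm z) > 0" using assms by (simp add: add_pos_nonneg)
  have "4 * hyp_dist z 0 = 2 * ln ((1 + norm z) / (1 - norm z))"
    using hyp_dist_0[of z] assms by (simp add: hyp_dist_commute[of z])
  hence "exp (4 * hyp_dist z 0) = (exp (ln ((1 + norm z) / (1 - norm z))))\<^sup>2"
    by (simp only: exp_double)
  thus ?thesis using pos by simp
qed

text \<open>The inequality normalised at the origin.  The rotation is the one through the argument of
  \<open>deriv F 0\<close>; if the derivative vanishes, any rotation is close enough.\<close>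

lemma close_to_rotation:
  assumes F: "F \<in> Hol_disc" and F0: "F 0 = 0"
  obtains \<alpha> where "norm \<alpha> = 1"
    and "\<And>z. norm z < 1 \<Longrightarrow>
      hyp_dist (F z) (\<alpha> * z) \<le> 2 * exp (4 * hyp_dist z 0) * (1 - norm (deriv F 0))"
proof -
  define a where "a = norm (deriv F 0)"
  have hol: "F holomorphic_on \<D>" and FD: "\<And>z. norm z < 1 \<Longrightarrow> norm (F z) < 1"
    using F by (force simp: Hol_disc_def)+
  note SL = Schwarz_Lemma[OF hol F0 FD]
  have a1: "a \<le> 1" using SL(2)[of 0] by (simp add: a_def)
  obtain h where h: "h holomorphic_on \<D>" "\<And>z. norm z < 1 \<Longrightarrow> F z = z * h z" "deriv F 0 = h 0"
    using Schwarz3[OF hol F0] by metis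
  show ?thesis
    \<comment> \<open>In the equality case of the Schwarz lemma \<open>h\<close> has modulus \<open>1\<close> and does not map into the open
      disc, so the Schwarz--Pick estimate is unavailable; but then \<open>F\<close> is a rotation.\<close>
  proof (cases "(\<exists>z. norm z < 1 \<and> z \<noteq> 0 \<and> norm (F z) = norm z) \<or> norm (deriv F 0) = 1")
    case True
    then obtain \<alpha> where \<alpha>: "\<And>z. norm z < 1 \<Longrightarrow> F z = \<alpha> * z" "norm \<alpha> = 1"
      using SL(3)[of 0] by auto
    \<comment> \<open>The distance is \<open>0\<close>, but the right-hand side still has to be nonnegative: hence \<open>a \<le> 1\<close>.\<close>
    show ?thesis
      by (rule that[OF \<alpha>(2)]) (use a1 in \<open>simp add: \<alpha>(1) hyp_dist_def flip: a_def\<close>)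
  next
    case False
    define \<alpha> where "\<alpha> = (if h 0 = 0 then 1 else sgn (h 0))"
    have \<alpha>: "norm \<alpha> = 1" "h 0 = \<alpha> * of_real a"
      by (simp_all add: \<alpha>_def norm_sgn) (simp add: a_def h(3) sgn_eq)
    have \<alpha>c: "cnj \<alpha> * \<alpha> = 1" using \<alpha>(1) by (simp add: mult.commute flip: complex_norm_square)
    define k where "k z = cnj \<alpha> * h z" for z
    have "norm (h z) < 1" if z: "norm z < 1" for z
    proof (cases "z = 0")
      case True
      thus ?thesis using False a1 by (simp add: a_def h(3))
    next
      case z0: False
      have "norm (F z) < norm z" using SL(1)[OF _ z] False z z0 by force
      thus ?thesis using z0 by (simp add: h(2)[OF z] norm_mult)
    qed
    hence "norm (k z) < 1" if "norm z < 1" for z using that \<alpha>(1) by (simp add: k_def norm_mult)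
    moreover have "k holomorphic_on \<D>" unfolding k_def[abs_def] by (intro holomorphic_intros h(1))
    ultimately have k: "k \<in> Hol_disc" by (auto simp: Hol_disc_def)
    have k0: "k 0 = of_real a" "0 \<le> a"
      using \<alpha>c by (simp_all add: k_def \<alpha>(2) flip: mult.assoc) (simp add: a_def)
    have "hyp_dist (F z) (\<alpha> * z) \<le> 2 * exp (4 * hyp_dist z 0) * (1 - a)" if z: "norm z < 1" for z
    proof -
      define r where "r = norm z"
      have r: "0 \<le> r" "r < 1" using z by (auto simp: r_def)
      have "F z - \<alpha> * z = - (\<alpha> * z * (1 - k z))"
      proof -
        have "h z = cnj \<alpha> * \<alpha> * h z" by (simp add: \<alpha>c)
        hence "h z = \<alpha> * k z" by (simp only: k_def ac_simps)
        thus ?thesis by (simp add: h(2)[OF z] algebra_simps)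
      qed
      hence n: "norm (F z - \<alpha> * z) = r * norm (1 - k z)"
        by (simp only: norm_minus_cancel norm_mult \<alpha>(1) r_def)
      have "hyp_dist (F z) (\<alpha> * z) \<le> r * norm (1 - k z) / (1 - r\<^sup>2)"
        using hyp_dist_le_of_norm_le[of "F z" r "\<alpha> * z"] SL(1)[OF _ z] r \<alpha>(1)
        by (simp add: n norm_mult r_def)
      also have "\<dots> \<le> r * ((1 - a) * (1 + r) / (1 - r)) / (1 - r\<^sup>2)"
        using norm_one_minus_le_of_Hol_disc[OF k k0 z] r
        by (intro divide_right_mono mult_left_mono)
          (auto simp: pos_le_divide_eq r_def abs_square_le_1)
      also have "\<dots> = r * (1 - a) / (1 - r)\<^sup>2"
      proof -
        have "1 - r\<^sup>2 = (1 + r) * (1 - r)" by (simp add: power2_eq_square algebra_simps)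
        thus ?thesis using r by (simp add: power2_eq_square)
      qed
      also have "\<dots> \<le> (2 * (1 + r)\<^sup>2) * (1 - a) / (1 - r)\<^sup>2"
      proof (intro divide_right_mono mult_right_mono)
        show "r \<le> 2 * (1 + r)\<^sup>2" using r by (simp add: power2_eq_square algebra_simps)
      qed (use a1 in auto)
      also have "\<dots> = 2 * exp (4 * hyp_dist z 0) * (1 - a)"
        by (simp add: exp_hyp_dist_0[OF z] power_divide r_def)
      finally show ?thesis .
    qed
    thus ?thesis using that \<alpha>(1) unfolding a_def by blast
  qed
qed

section \<open>Rigidity of holomorphic self-maps of the disc\<close>

theorem theoremF:
  fixes f :: "complex \<Rightarrow> complex" and w :: complex
  assumes "f \<in> Hol_disc" and "w \<in> \<D>"
  shows "\<exists>\<gamma>\<in>Aut_disc. \<forall>z\<in>\<D>.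
    hyp_dist (f z) (\<gamma> z) \<le> 2 * exp (4 * hyp_dist z w) * (1 - hyp_distortion f w)"
proof -
  let ?T = "Moebius_function 0"
  have w: "norm w < 1" using assms(2) by simp
  have fD: "norm (f z) < 1" if "norm z < 1" for z
    using assms(1) that by (force simp: Hol_disc_def)
  have T: "norm (?T a z) < 1" if "norm a < 1" "norm z < 1" for a z
    using that by (rule Moebius_function_norm_lt_1)
  have Tinv: "?T (- a) (?T a z) = z" "?T a (?T (- a) z) = z" if "norm a < 1" "norm z < 1" for a z
    using that by (auto intro!: Moebius_function_compose)
  define F where "F = ?T (f w) \<circ> f \<circ> ?T (- w)"
  have F: "F \<in> Hol_disc"
    unfolding F_def using w fD assms(1)
    by (intro comp_in_Hol_disc Moebius_function_in_Hol_disc) auto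
  have F0: "F 0 = 0" by (simp add: F_def Moebius_function_of_zero Moebius_function_eq_zero)
  obtain \<alpha> where \<alpha>: "norm \<alpha> = 1"
    and close: "\<And>z. norm z < 1 \<Longrightarrow>
      hyp_dist (F z) (\<alpha> * z) \<le> 2 * exp (4 * hyp_dist z 0) * (1 - norm (deriv F 0))"
    using close_to_rotation[OF F F0] by blast
  have \<alpha>c: "cnj \<alpha> * \<alpha> = 1" "\<alpha> * cnj \<alpha> = 1"
    using \<alpha> by (simp_all add: mult.commute flip: complex_norm_square)
  define \<gamma> where "\<gamma> = ?T (- f w) \<circ> (\<lambda>z. \<alpha> * z) \<circ> ?T w"
  define \<delta> where "\<delta> = ?T (- w) \<circ> (\<lambda>z. cnj \<alpha> * z) \<circ> ?T (f w)"
  have "\<gamma> \<in> Aut_disc"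
  proof (rule Aut_discI[where h = \<delta>])
    show "\<gamma> \<in> Hol_disc" "\<delta> \<in> Hol_disc"
      unfolding \<gamma>_def \<delta>_def using w fD \<alpha>
      by (auto intro!: comp_in_Hol_disc Moebius_function_in_Hol_disc rotation_in_Hol_disc)
    show "\<delta> (\<gamma> z) = z" "\<gamma> (\<delta> z) = z" if "z \<in> \<D>" for z
      using that w fD[OF w] \<alpha> \<alpha>c
      by (simp_all add: \<gamma>_def \<delta>_def Tinv T norm_mult flip: mult.assoc)
  qed
  moreover have "hyp_dist (f z) (\<gamma> z) \<le> 2 * exp (4 * hyp_dist z w) * (1 - hyp_distortion f w)"
    if "z \<in> \<D>" for z
  proof -
    have z: "norm z < 1" using that by simp
    define u where "u = ?T w z"
    have u: "norm u < 1" unfolding u_def using w z by (rule T)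
    have \<alpha>u: "norm (\<alpha> * u) < 1" using u \<alpha> by (simp add: norm_mult)
    have "hyp_dist (f z) (\<gamma> z) = hyp_dist (?T (f w) (f z)) (?T (f w) (?T (- f w) (\<alpha> * u)))"
      using hyp_dist_Moebius_function[of "f w" "f z" "\<gamma> z"] fD w z T[of "- f w" "\<alpha> * u"] \<alpha>u
      by (simp add: \<gamma>_def u_def)
    also have "\<dots> = hyp_dist (F u) (\<alpha> * u)"
      using Tinv fD w z \<alpha>u by (simp add: F_def u_def)
    also have "\<dots> \<le> 2 * exp (4 * hyp_dist u 0) * (1 - norm (deriv F 0))"
      using u by (rule close)
    also have "hyp_dist u 0 = hyp_dist z w"
      using hyp_dist_Moebius_function[of w z w] w z by (simp add: u_def Moebius_function_eq_zero)
    also have "norm (deriv F 0) = hyp_distortion f w"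
      unfolding F_def using assms by (rule hyp_distortion_Moebius_conjugate)
    finally show ?thesis .
  qed
  ultimately show ?thesis by blast
qed

end
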